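(* Let $f:\mathbb{R}^n\to\mathbb{R}$ be $L$-smooth with $\arg\min f\neq\emptyset$, let $f^\star=\min f$, and let $h>0$. Let $\{x_k\}_{k=0}^\infty\subset\mathbb{R}^n$ and $\{\eta_k\}_{k=0}^\infty\subset\mathbb{R}$ be sequences satisfying, for all $k\ge0$, $$\frac{x_{k+1}-x_k}{h}=-\eta_k\nabla f(x_k),\qquad f(x_{k+1})-f(x_k)=\eta_k\langle\nabla f(x_k),x_{k+1}-x_k\rangle,$$ and $\eta_k\neq0$ for any non-negative integer $k$. If $f$ satisfies the Polyak--Łojasiewicz inequality with parameter $\mu>0$, then for every integer $k\ge0$ $$f(x_k)-f^\star\leq\exp\left(-\frac{8\mu kh}{(Lh+2)^2}\right)\left(f(x_0)-f^\star\right).$$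
   Context: A function $f$ is $L$-smooth ($L>0$) if it is differentiable and $\nabla f$ is Lipschitz continuous with constant $L$. $f$ satisfies the Polyak--Łojasiewicz inequality with parameter $\mu>0$ if $\frac12\|\nabla f(x)\|^2\ge\mu(f(x)-f^\star)$ for all $x\in\mathbb{R}^n$, where $\|\cdot\|$ is the Euclidean norm. *)

theory Defs
  imports "HOL-Analysis.Analysis"
begin

definition grad :: "('a::real_inner \<Rightarrow> real) \<Rightarrow> 'a \<Rightarrow> 'a" where
  "grad f x = (THE D. GDERIV f x :> D)"

lemma grad_eqI:
  fixes f :: "'a::real_inner \<Rightarrow> real"
  assumes "GDERIV f x :> D"
  shows "grad f x = D"
  unfolding grad_def
proof (rule the_equality)
  show "GDERIV f x :> D" by (fact assms)
next
  fix E assume "GDERIV f x :> E"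
  then have "(\<lambda>h. inner h E) = (\<lambda>h. inner h D)"
    using assms has_derivative_unique unfolding gderiv_def by blast
  then have "inner (E - D) E = inner (E - D) D" by metis
  then have "inner (E - D) (E - D) = 0" by (simp add: inner_diff_right)
  then show "E = D" by simp
qed

lemma differentiable_GDERIV_grad:
  fixes f :: "'a::euclidean_space \<Rightarrow> real"
  assumes "f differentiable (at x)"
  shows "GDERIV f x :> grad f x"
proof -
  obtain f' where f': "(f has_derivative f') (at x)"
    using assms unfolding differentiable_def by blast
  interpret bounded_linear f' using f' by (rule has_derivative_bounded_linear)
  have "f' h = inner h (\<Sum>b\<in>Basis. f' b *\<^sub>R b)" for h
  proof -
    have "f' h = f' (\<Sum>b\<in>Basis. inner h b *\<^sub>R b)" by (simp add: euclidean_representation)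
    also have "\<dots> = (\<Sum>b\<in>Basis. inner h b * f' b)" by (simp add: sum scaleR)
    also have "\<dots> = inner h (\<Sum>b\<in>Basis. f' b *\<^sub>R b)"
      by (simp add: inner_sum_right mult.commute)
    finally show ?thesis .
  qed
  then have "f' = (\<lambda>h. inner h (\<Sum>b\<in>Basis. f' b *\<^sub>R b))" by blast
  then have "GDERIV f x :> (\<Sum>b\<in>Basis. f' b *\<^sub>R b)"
    using f' unfolding gderiv_def by metis
  then show ?thesis using grad_eqI by metis
qed

definition L_smooth :: "real \<Rightarrow> ('a::real_inner \<Rightarrow> real) \<Rightarrow> bool" where
  "L_smooth L f \<longleftrightarrow> L > 0 \<and> (\<forall>x. f differentiable (at x)) \<and> L-lipschitz_on UNIV (grad f)"

(* The least element of the range; meaningful only when f attains its minimum. *)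
definition min_value :: "('a \<Rightarrow> real) \<Rightarrow> real" where
  "min_value f = (LEAST v. v \<in> range f)"

lemma min_value_eq:
  assumes "is_arg_min f (\<lambda>_. True) z"
  shows "min_value f = f z"
  unfolding min_value_def
  using assms by (intro Least_equality) (auto simp: is_arg_min_linorder)

definition PL_inequality :: "real \<Rightarrow> ('a::real_inner \<Rightarrow> real) \<Rightarrow> bool" where
  "PL_inequality \<mu> f \<longleftrightarrow>
     \<mu> > 0 \<and> (\<forall>x. 1 / 2 * (norm (grad f x))\<^sup>2 \<ge> \<mu> * (f x - min_value f))"

end

(* With g the gradient at x_k, the two recursions say f x_(k+1) - f x_k = - h \<eta>^2 |g|^2, while the
   linear term at x_k is - h \<eta> |g|^2.  The two-sided quadratic estimate for L-smooth functions thus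
   gives |\<eta> - \<eta>^2| \<le> L h \<eta>^2 / 2 when g \<noteq> 0, hence |\<eta>| \<ge> 2 / (L h + 2) whatever the sign of \<eta>.
   So f decreases by at least 4 h |g|^2 / (L h + 2)^2, and the PL inequality turns this into a
   contraction of f - min f by the factor 1 - 8 \<mu> h / (L h + 2)^2. *)
theory Submission
  imports Defs
begin

text \<open>On the segment from \<open>x\<close> to \<open>y\<close>, let \<open>p\<close> be
  \<open>f\<close> minus its quadratic majorant. By Cauchy-Schwarz and the Lipschitz bound the slope
  of \<open>p\<close> is nonpositive on [0, 1], so comparing \<open>p 1\<close> with
  \<open>p 0\<close> replaces integrating the gradient.\<close>

lemma lipschitz_gradient_upper_bound:
  fixes f :: "'a::real_inner \<Rightarrow> real"
  assumes G: "\<And>z. GDERIV f z :> G z"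
    and lip: "L-lipschitz_on UNIV G"
  shows "f y \<le> f x + inner (G x) (y - x) + L / 2 * (norm (y - x))\<^sup>2"
proof -
  define d where "d = y - x"
  define p where "p t = f (x + t *\<^sub>R d) - t * inner (G x) d - L / 2 * t\<^sup>2 * (norm d)\<^sup>2" for t
  have deriv: "(p has_real_derivative
      inner (G (x + t *\<^sub>R d)) d - inner (G x) d - L * t * (norm d)\<^sup>2) (at t)" for t
  proof -
    have "(f has_derivative (\<lambda>v. inner v (G (x + t *\<^sub>R d)))) (at (x + t *\<^sub>R d))"
      using G unfolding gderiv_def .
    moreover have "((\<lambda>t. x + t *\<^sub>R d) has_derivative (\<lambda>s. s *\<^sub>R d)) (at t)"
      by (auto intro!: derivative_eq_intros)
    ultimately have "((\<lambda>t. f (x + t *\<^sub>R d)) has_derivative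
        (\<lambda>s. inner (s *\<^sub>R d) (G (x + t *\<^sub>R d)))) (at t)"
      by (rule has_derivative_compose[rotated])
    then have "((\<lambda>t. f (x + t *\<^sub>R d)) has_real_derivative inner (G (x + t *\<^sub>R d)) d) (at t)"
      unfolding has_field_derivative_def
      by (simp add: inner_commute mult.commute[of "inner d _"] mult_commute_abs)
    then show ?thesis
      unfolding p_def by (auto intro!: derivative_eq_intros)
  qed
  have "p 1 \<le> p 0"
  proof (rule DERIV_nonpos_imp_nonincreasing[of 0 1 p])
    fix t :: real assume "0 \<le> t" "t \<le> 1"
    have "inner (G (x + t *\<^sub>R d)) d - inner (G x) d = inner (G (x + t *\<^sub>R d) - G x) d"
      by (simp add: inner_diff_left)
    also have "\<dots> \<le> norm (G (x + t *\<^sub>R d) - G x) * norm d"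
      by (rule norm_cauchy_schwarz)
    also have "\<dots> \<le> (L * norm (t *\<^sub>R d)) * norm d"
      using lipschitz_onD[OF lip, of "x + t *\<^sub>R d" x]
      by (intro mult_right_mono) (auto simp: dist_norm)
    also have "\<dots> = L * t * (norm d)\<^sup>2"
      using \<open>0 \<le> t\<close> by (simp add: power2_eq_square)
    finally show "\<exists>m. (p has_real_derivative m) (at t) \<and> m \<le> 0"
      using deriv[of t] by force
  qed simp
  then show ?thesis
    by (simp add: p_def d_def)
qed

text \<open>The one-sided estimate also applies to \<open>- f\<close>, whose gradient has the same
  Lipschitz constant. The lower estimate obtained this way is what later controls negative
  \<open>\<eta>\<close>.\<close>

lemma L_smooth_quadratic_bound:
  fixes f :: "'a::euclidean_space \<Rightarrow> real"
  assumes "L_smooth L f"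
  shows "\<bar>f y - f x - inner (grad f x) (y - x)\<bar> \<le> L / 2 * (norm (y - x))\<^sup>2"
proof -
  have G: "GDERIV f z :> grad f z" for z
    using assms unfolding L_smooth_def by (blast intro: differentiable_GDERIV_grad)
  have lip: "L-lipschitz_on UNIV (grad f)"
    using assms unfolding L_smooth_def by blast
  have "GDERIV (\<lambda>z. - f z) z :> - grad f z" for z
    by (rule GDERIV_minus) (rule G)
  moreover have "L-lipschitz_on UNIV (\<lambda>z. - grad f z)"
    using lip by (simp add: lipschitz_on_def dist_norm norm_minus_commute)
  ultimately have "- f y \<le> - f x + inner (- grad f x) (y - x) + L / 2 * (norm (y - x))\<^sup>2"
    by (rule lipschitz_gradient_upper_bound)
  with lipschitz_gradient_upper_bound[OF G lip, of y x] show ?thesis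
    unfolding abs_le_iff inner_minus_left by linarith
qed

text \<open>Here \<open>c\<close> stands for \<open>L * h\<close>. Splitting \<eta> as (\<eta> -
  \<eta>^2) + \<eta>^2 gives |\<eta>| \<le> (c / 2 + 1) \<eta>^2; cancel one factor |\<eta>| > 0,
  then square.\<close>

lemma discrete_gradient_step_lower_bound:
  fixes \<eta> :: real
  assumes "\<eta> \<noteq> 0" "c \<ge> 0" "\<bar>\<eta> - \<eta>\<^sup>2\<bar> \<le> c / 2 * \<eta>\<^sup>2"
  shows "4 / (c + 2)\<^sup>2 \<le> \<eta>\<^sup>2"
proof -
  have "\<bar>\<eta>\<bar> \<le> \<bar>\<eta> - \<eta>\<^sup>2\<bar> + \<eta>\<^sup>2"
    using abs_triangle_ineq[of "\<eta> - \<eta>\<^sup>2" "\<eta>\<^sup>2"] by simp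
  also have "\<dots> \<le> \<bar>\<eta>\<bar> * (\<bar>\<eta>\<bar> * ((c + 2) / 2))"
    using assms(3) by (simp add: algebra_simps power2_eq_square flip: abs_mult)
  finally have "\<bar>\<eta>\<bar> * 1 \<le> \<bar>\<eta>\<bar> * (\<bar>\<eta>\<bar> * ((c + 2) / 2))"
    by simp
  then have "1 \<le> \<bar>\<eta>\<bar> * ((c + 2) / 2)"
    using assms(1) by (subst (asm) mult_le_cancel_left_pos) auto
  then have "2 / (c + 2) \<le> \<bar>\<eta>\<bar>"
    using assms(2) by (simp add: field_simps)
  then have "(2 / (c + 2))\<^sup>2 \<le> \<bar>\<eta>\<bar>\<^sup>2"
    by (rule power_mono) (use assms(2) in auto)
  then show ?thesis
    by (simp add: power_divide)
qed

lemma discrete_gradient_decrease: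
  fixes f :: "'a::euclidean_space \<Rightarrow> real"
  assumes smooth: "L_smooth L f" and h: "h > 0"
    and step: "(y - x) /\<^sub>R h = - (\<eta> *\<^sub>R grad f x)"
    and decr: "f y - f x = \<eta> * inner (grad f x) (y - x)"
    and nz: "\<eta> \<noteq> 0"
  shows "f y \<le> f x - 4 * h / (L * h + 2)\<^sup>2 * (norm (grad f x))\<^sup>2"
proof -
  define N where "N = (norm (grad f x))\<^sup>2"
  have L: "L > 0"
    using smooth unfolding L_smooth_def by blast
  have "y - x = h *\<^sub>R ((y - x) /\<^sub>R h)"
    using h by simp
  also have "\<dots> = - ((h * \<eta>) *\<^sub>R grad f x)"
    unfolding step by simp
  finally have d: "y - x = - ((h * \<eta>) *\<^sub>R grad f x)" .
  have inner: "inner (grad f x) (y - x) = - (h * \<eta> * N)"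
    by (simp add: d N_def power2_norm_eq_inner)
  have diff: "f y - f x = - (h * \<eta>\<^sup>2 * N)"
    using decr by (simp add: inner power2_eq_square)
  \<comment> \<open>At a critical point (\<open>N = 0\<close>) the smoothness estimate says nothing
    about \<open>\<eta>\<close>, but both sides vanish. Keeping the factor \<open>N\<close> in the
    claim covers this case.\<close>
  have "4 / (L * h + 2)\<^sup>2 * N \<le> \<eta>\<^sup>2 * N"
  proof (cases "N = 0")
    case False
    then have N: "N > 0"
      by (simp add: N_def)
    \<comment> \<open>The squared step length is h^2 \<eta>^2 N, so \<open>h * N\<close> is a common
      positive factor of both sides of the quadratic bound and can be cancelled.\<close>
    have "(h * N) * \<bar>\<eta> - \<eta>\<^sup>2\<bar> = \<bar>h * N * (\<eta> - \<eta>\<^sup>2)\<bar>"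
      using h N by (simp add: abs_mult)
    also have "\<dots> = \<bar>f y - f x - inner (grad f x) (y - x)\<bar>"
      unfolding diff inner by (simp add: algebra_simps)
    also have "\<dots> \<le> L / 2 * (norm (y - x))\<^sup>2"
      by (rule L_smooth_quadratic_bound[OF smooth])
    also have "\<dots> = (h * N) * (L * h / 2 * \<eta>\<^sup>2)"
      by (simp add: d N_def power_mult_distrib power2_eq_square)
    finally have "\<bar>\<eta> - \<eta>\<^sup>2\<bar> \<le> L * h / 2 * \<eta>\<^sup>2"
      using h N by (subst (asm) mult_le_cancel_left_pos) auto
    with nz have "4 / (L * h + 2)\<^sup>2 \<le> \<eta>\<^sup>2"
      by (intro discrete_gradient_step_lower_bound) (use L h in auto)
    then show ?thesis
      using N by (intro mult_right_mono) auto
  qed simp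
  then have "h * (4 / (L * h + 2)\<^sup>2 * N) \<le> h * (\<eta>\<^sup>2 * N)"
    using h by (intro mult_left_mono) auto
  with diff show ?thesis
    by (simp add: N_def mult.assoc mult.commute mult.left_commute)
qed

theorem theorem4p4:
  fixes f :: "real ^ 'n \<Rightarrow> real"
    and L h \<mu> :: real
    and x :: "nat \<Rightarrow> real ^ 'n"
    and \<eta> :: "nat \<Rightarrow> real"
  assumes smooth: "L_smooth L f"
    and argmin: "{z. is_arg_min f (\<lambda>_. True) z} \<noteq> {}"
    and h: "h > 0"
    and step: "\<And>k. (x (Suc k) - x k) /\<^sub>R h = - (\<eta> k *\<^sub>R grad f (x k))"
    and decr: "\<And>k. f (x (Suc k)) - f (x k) = \<eta> k * inner (grad f (x k)) (x (Suc k) - x k)"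
    and nz: "\<And>k. \<eta> k \<noteq> 0"
    and PL: "PL_inequality \<mu> f"
  shows "\<forall>k. f (x k) - min_value f
           \<le> exp (- (8 * \<mu> * real k * h / (L * h + 2)\<^sup>2)) * (f (x 0) - min_value f)"
proof -
  \<comment> \<open>The contraction rate of one step: the decrease constant 4 doubles to 8 because
    the PL inequality bounds half the squared gradient norm.\<close>
  define c where "c = 8 * \<mu> * h / (L * h + 2)\<^sup>2"
  define e where "e k = f (x k) - min_value f" for k
  obtain z where z: "is_arg_min f (\<lambda>_. True) z"
    using argmin by blast
  have e_nonneg: "0 \<le> e k" for k
    using z by (auto simp: e_def min_value_eq[OF z] is_arg_min_linorder)
  have e_Suc: "e (Suc k) \<le> exp (- c) * e k" for k
  proof -
    have "\<mu> * e k \<le> 1 / 2 * (norm (grad f (x k)))\<^sup>2"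
      using PL unfolding PL_inequality_def e_def by blast
    then have "8 * h / (L * h + 2)\<^sup>2 * (\<mu> * e k)
        \<le> 8 * h / (L * h + 2)\<^sup>2 * (1 / 2 * (norm (grad f (x k)))\<^sup>2)"
      by (rule mult_left_mono) (use h in auto)
    then have "c * e k \<le> 4 * h / (L * h + 2)\<^sup>2 * (norm (grad f (x k)))\<^sup>2"
      by (simp add: c_def mult.assoc mult.commute mult.left_commute)
    moreover have "f (x (Suc k)) \<le> f (x k) - 4 * h / (L * h + 2)\<^sup>2 * (norm (grad f (x k)))\<^sup>2"
      using smooth h step decr nz by (rule discrete_gradient_decrease)
    ultimately have "e (Suc k) \<le> (1 + - c) * e k"
      by (simp add: e_def algebra_simps)
    \<comment> \<open>From 1 - c \<le> exp (- c). Multiplying by \<open>e k\<close> keeps the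
      direction because the gap to the minimum is nonnegative; the sign of 1 - c does not
      matter.\<close>
    also have "\<dots> \<le> exp (- c) * e k"
      by (intro mult_right_mono exp_ge_add_one_self e_nonneg)
    finally show ?thesis .
  qed
  have "e k \<le> exp (- (c * real k)) * e 0" for k
  proof (induction k)
    case (Suc k)
    have "e (Suc k) \<le> exp (- c) * e k"
      by (rule e_Suc)
    \<comment> \<open>Iterating with the positive factor \<open>exp (- c)\<close> instead of 1 - c
      makes it safe to multiply the induction hypothesis.\<close>
    also have "\<dots> \<le> exp (- c) * (exp (- (c * real k)) * e 0)"
      by (intro mult_left_mono Suc.IH) simp
    also have "\<dots> = exp (- (c * real (Suc k))) * e 0"
      by (simp add: algebra_simps flip: exp_add)
    finally show ?case .
  qed simp
  then show ?thesis
    by (simp add: e_def c_def mult.assoc mult.commute mult.left_commute)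
qed

end
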